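(* Let $G$ be a Halin graph. Then every subgraph $H$ of $G$ with $\Delta(H)\geq 4$ satisfies $\chi'(H)=\Delta(H)$ (i.e., is Class 1).
   Context: Graphs are finite and simple. A Halin graph is a graph $T\cup C$, where $T$ is a plane tree on at least four vertices with no vertex of degree 2, and $C$ is a cycle connecting the leaves of $T$ in the cyclic order determined by the embedding of $T$. $\chi'(H)$ denotes the chromatic index and $\Delta(H)$ the maximum degree. *)

theory Defs
  imports "HOL-Combinatorics.Orbits"
begin

type_synonym 'a ugraph = "'a set \<times> 'a set set"

abbreviation vertices :: "'a ugraph \<Rightarrow> 'a set" where "vertices G \<equiv> fst G"
abbreviation edges :: "'a ugraph \<Rightarrow> 'a set set" where "edges G \<equiv> snd G"

definition simple_graph :: "'a ugraph \<Rightarrow> bool" where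
  "simple_graph G \<longleftrightarrow>
     finite (vertices G) \<and> (\<forall>e \<in> edges G. e \<subseteq> vertices G \<and> card e = 2)"

definition is_subgraph :: "'a ugraph \<Rightarrow> 'a ugraph \<Rightarrow> bool" where
  "is_subgraph H G \<longleftrightarrow>
     simple_graph H \<and> vertices H \<subseteq> vertices G \<and> edges H \<subseteq> edges G"

definition neighbours :: "'a ugraph \<Rightarrow> 'a \<Rightarrow> 'a set" where
  "neighbours G v = {u. {u, v} \<in> edges G}"

definition vdegree :: "'a ugraph \<Rightarrow> 'a \<Rightarrow> nat" where
  "vdegree G v = card {e \<in> edges G. v \<in> e}"

text \<open>The inserted \<open>0\<close> only matters for the graph without vertices.\<close>

definition max_degree :: "'a ugraph \<Rightarrow> nat" where
  "max_degree G = Max (insert 0 (vdegree G ` vertices G))"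

definition proper_edge_colouring :: "'a ugraph \<Rightarrow> nat \<Rightarrow> ('a set \<Rightarrow> nat) \<Rightarrow> bool" where
  "proper_edge_colouring G k c \<longleftrightarrow>
     (\<forall>e \<in> edges G. c e < k) \<and>
     (\<forall>e \<in> edges G. \<forall>f \<in> edges G. e \<noteq> f \<and> e \<inter> f \<noteq> {} \<longrightarrow> c e \<noteq> c f)"

definition chromatic_index :: "'a ugraph \<Rightarrow> nat" where
  "chromatic_index G = (LEAST k. \<exists>c. proper_edge_colouring G k c)"

definition connected_graph :: "'a ugraph \<Rightarrow> bool" where
  "connected_graph G \<longleftrightarrow> vertices G \<noteq> {} \<and>
     (\<forall>u \<in> vertices G. \<forall>v \<in> vertices G. (\<lambda>x y. {x, y} \<in> edges G)\<^sup>*\<^sup>* u v)"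

definition cycle_edges :: "'a list \<Rightarrow> 'a set set" where
  "cycle_edges xs = {{xs ! i, xs ! (Suc i mod length xs)} | i. i < length xs}"

definition acyclic_graph :: "'a ugraph \<Rightarrow> bool" where
  "acyclic_graph G \<longleftrightarrow>
     \<not> (\<exists>xs. 3 \<le> length xs \<and> distinct xs \<and> cycle_edges xs \<subseteq> edges G)"

definition is_tree :: "'a ugraph \<Rightarrow> bool" where
  "is_tree T \<longleftrightarrow> simple_graph T \<and> connected_graph T \<and> acyclic_graph T"

definition leaves :: "'a ugraph \<Rightarrow> 'a set" where
  "leaves T = {v \<in> vertices T. vdegree T v = 1}"

text \<open>A plane tree is given combinatorially, by a rotation system: \<open>rot v\<close> is the cyclic
  permutation of the neighbours of \<open>v\<close> in which they appear around \<open>v\<close> in the plane.\<close>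

definition plane_tree :: "'a ugraph \<Rightarrow> ('a \<Rightarrow> 'a \<Rightarrow> 'a) \<Rightarrow> bool" where
  "plane_tree T rot \<longleftrightarrow>
     is_tree T \<and> (\<forall>v \<in> vertices T. cyclic_on (rot v) (neighbours T v))"

text \<open>The walk around the unique face of a plane tree: an edge traversed from \<open>u\<close> to \<open>v\<close> is
  followed by the edge from \<open>v\<close> to the neighbour succeeding \<open>u\<close> around \<open>v\<close>. Each leaf is visited
  exactly once, and the order of these visits is the cyclic order of the leaves in the plane.\<close>

definition face_step :: "('a \<Rightarrow> 'a \<Rightarrow> 'a) \<Rightarrow> 'a \<times> 'a \<Rightarrow> 'a \<times> 'a" where
  "face_step rot = (\<lambda>(u, v). (v, rot v u))"

definition next_leaf :: "'a ugraph \<Rightarrow> ('a \<Rightarrow> 'a \<Rightarrow> 'a) \<Rightarrow> 'a \<Rightarrow> 'a \<Rightarrow> bool" where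
  "next_leaf T rot l l' \<longleftrightarrow> l \<in> leaves T \<and> l' \<in> leaves T \<and>
     (\<exists>u \<in> neighbours T l. \<exists>n > 0.
        snd ((face_step rot ^^ n) (u, l)) = l' \<and>
        (\<forall>m. 0 < m \<and> m < n \<longrightarrow> snd ((face_step rot ^^ m) (u, l)) \<notin> leaves T))"

definition leaf_cycle :: "'a ugraph \<Rightarrow> ('a \<Rightarrow> 'a \<Rightarrow> 'a) \<Rightarrow> 'a list \<Rightarrow> bool" where
  "leaf_cycle T rot ls \<longleftrightarrow>
     3 \<le> length ls \<and> distinct ls \<and> set ls = leaves T \<and>
     (\<forall>i < length ls. next_leaf T rot (ls ! i) (ls ! (Suc i mod length ls)))"

definition halin_graph :: "'a ugraph \<Rightarrow> bool" where
  "halin_graph G \<longleftrightarrow>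
     (\<exists>T rot ls.
        plane_tree T rot \<and> 4 \<le> card (vertices T) \<and> (\<forall>v \<in> vertices T. vdegree T v \<noteq> 2) \<and>
        leaf_cycle T rot ls \<and>
        G = (vertices T, edges T \<union> cycle_edges ls))"

end

theory Submission
  imports Defs
begin

text \<open>Write \<open>k \<ge> 4\<close> for the maximum degree of \<open>H\<close>. The tree edges of \<open>H\<close> form a forest, hence have
  a proper colouring with \<open>k\<close> colours, and every such colouring extends to the cycle edges. A cycle
  edge only has to avoid the colours of the pendant edges at its two ends and of the two adjacent
  cycle edges, so going around the cycle greedily can only fail at the last edge. It does not fail
  there if that edge has equal pendant colours at its ends, or if the first edge can be given a
  colour that is already forbidden for the last one. A cycle without such a starting place has
  pendant colours alternating between two values, and then two other colours may alternate
  on the cycle edges.\<close>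

section \<open>Periodic sequences and free colours\<close>

lemma periodic_add_mult:
  fixes p :: "nat \<Rightarrow> 'b"
  assumes "\<And>i. p (i + n) = p i"
  shows "p (i + n * s) = p i"
proof (induction s)
  case (Suc s)
  have "p (i + n * Suc s) = p ((i + n * s) + n)" by (simp add: ac_simps)
  then show ?case using Suc assms by metis
qed simp

lemma periodic_mod:
  fixes p :: "nat \<Rightarrow> 'b"
  assumes "\<And>i. p (i + n) = p i"
  shows "p (i mod n) = p i"
  using periodic_add_mult[of p n "i mod n" "i div n"] assms by simp

lemma ex_colour_not_in:
  fixes A :: "nat set"
  assumes "finite A" "card A < k"
  shows "\<exists>x<k. x \<notin> A"
  using assms card_mono[of A "{..<k}"] by fastforce

lemma ex_colour_avoiding_three:
  fixes a b c k :: nat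
  assumes "4 \<le> k"
  shows "\<exists>x<k. x \<noteq> a \<and> x \<noteq> b \<and> x \<noteq> c"
proof -
  have "card {a, b, c} \<le> 3" by (metis card_length length_Cons list.set list.size(3) numeral_3_eq_3)
  then show ?thesis using ex_colour_not_in[of "{a, b, c}" k] assms by auto
qed

section \<open>Colouring a cycle with pendant edges\<close>

text \<open>With the leaves numbered around the cycle, \<open>p i\<close> is the colour of the
  pendant edge at leaf \<open>i\<close> and \<open>q i\<close> that of the cycle edge from leaf
  \<open>i\<close> to leaf \<open>Suc i\<close>. Sequences of period \<open>n\<close> stand in for
  indices modulo \<open>n\<close>, so the edge closing the cycle needs no separate clause.\<close>

definition cycle_extension :: "nat \<Rightarrow> nat \<Rightarrow> (nat \<Rightarrow> nat) \<Rightarrow> (nat \<Rightarrow> nat) \<Rightarrow> bool" where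
  "cycle_extension k n p q \<longleftrightarrow>
     (\<forall>i. q (i + n) = q i \<and> q i < k \<and> q i \<noteq> p i \<and> q i \<noteq> p (Suc i) \<and> q i \<noteq> q (Suc i))"

text \<open>The edges are coloured in the order 0, ..., \<open>n - 1\<close>. Each one before the
  last has at most three forbidden colours. The last one could have four, but \<open>start\<close>
  lets two of them coincide: either its two pendant colours, or \<open>p (n - 1)\<close> and the
  colour of edge 0.\<close>

lemma cycle_extension_greedy:
  assumes k: "4 \<le> k" and n: "3 \<le> n" and per: "\<And>i. p (i + n) = p i" and pk: "\<And>i. p i < k"
    and start: "p (n - 1) = p n \<or> p (n - 1) \<noteq> p (Suc n)"
  shows "\<exists>q. cycle_extension k n p q"
proof -
  have pn: "p n = p 0" "p (Suc n) = p 1" using per[of 0] per[of 1] by simp_all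
  \<comment> \<open>The colour of edge 0. If \<open>p (n - 1)\<close> differs from
    \<open>p n\<close>, then \<open>p (n - 1)\<close> itself is taken; it differs from
    \<open>p 1\<close> by \<open>start\<close>.\<close>
  have "\<exists>r0<k. r0 \<noteq> p 0 \<and> r0 \<noteq> p 1 \<and> (p (n - 1) = p n \<or> r0 = p (n - 1))"
  proof (cases "p (n - 1) = p n")
    case True
    then show ?thesis using ex_colour_avoiding_three[OF k, of "p 0" "p 1" "p 1"] by auto
  next
    case False
    then show ?thesis using start pn pk by auto
  qed
  then obtain r0 where r0: "r0 < k" "r0 \<noteq> p 0" "r0 \<noteq> p 1" "p (n - 1) = p n \<or> r0 = p (n - 1)"
    by blast
  \<comment> \<open>The greedy choice gives an infinite sequence, of which only the entries up to
    \<open>n - 2\<close> enter \<open>q\<close>.\<close>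
  have "\<exists>r. \<forall>j. (r j < k \<and> r j \<noteq> p j \<and> r j \<noteq> p (Suc j) \<and> (j = 0 \<longrightarrow> r j = r0)) \<and> r (Suc j) \<noteq> r j"
  proof (rule dependent_nat_choice)
    show "\<exists>x. x < k \<and> x \<noteq> p 0 \<and> x \<noteq> p (Suc 0) \<and> (0 = (0::nat) \<longrightarrow> x = r0)"
      using r0 by simp
    show "\<exists>y. (y < k \<and> y \<noteq> p (Suc j) \<and> y \<noteq> p (Suc (Suc j)) \<and> (Suc j = 0 \<longrightarrow> y = r0)) \<and> y \<noteq> x"
      for x j
      using ex_colour_avoiding_three[OF k, of "p (Suc j)" "p (Suc (Suc j))" x] by auto
  qed
  then obtain r where r: "\<And>j. r j < k" "\<And>j. r j \<noteq> p j" "\<And>j. r j \<noteq> p (Suc j)"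
    "\<And>j. r (Suc j) \<noteq> r j" "r 0 = r0"
    by blast
  \<comment> \<open>The colour of the last edge, which meets both edge \<open>n - 2\<close> and edge
    0.\<close>
  obtain x where x: "x < k" "x \<noteq> p (n - 1)" "x \<noteq> p n" "x \<noteq> r (n - 2)" "x \<noteq> r0"
  proof (cases "p (n - 1) = p n")
    case True
    then show thesis
      using ex_colour_avoiding_three[OF k, of "p n" "r (n - 2)" r0] that by auto
  next
    case False
    then show thesis
      using ex_colour_avoiding_three[OF k, of "p n" "r (n - 2)" "p (n - 1)"] that r0(4) by auto
  qed
  define q where "q j = (if j mod n = n - 1 then x else r (j mod n))" for j
  have "q i < k \<and> q i \<noteq> p i \<and> q i \<noteq> p (Suc i) \<and> q i \<noteq> q (Suc i)" for i
  proof -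
    define m where "m = i mod n"
    have m: "m < n" using n by (simp add: m_def)
    have pm: "p i = p m" using periodic_mod[of p n i, OF per] by (simp add: m_def)
    have psm: "p (Suc i) = p (Suc m)"
      using periodic_mod[of p n "Suc m", OF per] periodic_mod[of p n "Suc i", OF per]
      by (simp add: m_def mod_Suc_eq)
    have sm: "Suc i mod n = (if m = n - 1 then 0 else Suc m)"
      using m by (auto simp: m_def mod_Suc)
    consider "m = n - 1" | "Suc m = n - 1" | "m < n - 1" "Suc m < n - 1" using m by linarith
    then show ?thesis
    proof cases
      case 1
      then have "q i = x" "q (Suc i) = r0" "Suc m = n"
        using n r(5) m by (simp_all add: q_def sm flip: m_def)
      then show ?thesis using x 1 pm psm by metis
    next
      case 2
      then have "q i = r m" "q (Suc i) = x" "m = n - 2"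
        using n by (simp_all add: q_def sm flip: m_def)
      then show ?thesis using x r(1-3)[of m] pm psm by metis
    next
      case 3
      then have "q i = r m" "q (Suc i) = r (Suc m)"
        by (simp_all add: q_def sm flip: m_def)
      then show ?thesis using r(1-4)[of m] pm psm by metis
    qed
  qed
  then have "cycle_extension k n p q" by (simp add: cycle_extension_def q_def)
  then show ?thesis by blast
qed

text \<open>If some edge satisfies the starting condition of \<open>cycle_extension_greedy\<close>,
  the numbering is rotated to make it the last edge. Otherwise \<open>p\<close> alternates between
  two values, and two further colours remain for the cycle edges.\<close>

lemma cycle_extension_exists:
  assumes k: "4 \<le> k" and n: "3 \<le> n" and per: "\<And>i. p (i + n) = p i" and pk: "\<And>i. p i < k"
  shows "\<exists>q. cycle_extension k n p q"
proof (cases "\<exists>s. p s = p (Suc s) \<or> p s \<noteq> p (Suc (Suc s))")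
  case True
  then obtain s where s: "p s = p (Suc s) \<or> p s \<noteq> p (Suc (Suc s))" by blast
  \<comment> \<open>Counting from \<open>Suc s\<close> puts edge \<open>s\<close> at position
    \<open>n - 1\<close>, up to one period.\<close>
  have shift: "p (n - 1 + Suc s) = p s" "p (n + Suc s) = p (Suc s)"
    "p (Suc n + Suc s) = p (Suc (Suc s))"
    using per[of s] per[of "Suc s"] per[of "Suc (Suc s)"] n by (simp_all add: ac_simps)
  have "\<exists>q. cycle_extension k n (\<lambda>j. p (j + Suc s)) q"
  proof (rule cycle_extension_greedy[OF k n])
    show "p (i + n + Suc s) = p (i + Suc s)" for i
      using per[of "i + Suc s"] by (simp add: ac_simps)
  qed (use pk s shift in auto)
  then obtain q where q: "cycle_extension k n (\<lambda>j. p (j + Suc s)) q" by blast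
  \<comment> \<open>A shift by \<open>d\<close> undoes the rotation without negative indices, as
    \<open>d + Suc s\<close> is a multiple of the period.\<close>
  define d where "d = n * Suc s - Suc s"
  have "1 * Suc s \<le> n * Suc s" using n by (intro mult_le_mono1) linarith
  then have d: "d + Suc s = n * Suc s" by (simp only: d_def le_add_diff_inverse2 mult_1)
  have pd: "p (j + d + Suc s) = p j" for j
    using periodic_add_mult[of p n j "Suc s", OF per] d by (simp only: add.assoc)
  have "cycle_extension k n p (\<lambda>j. q (j + d))"
    unfolding cycle_extension_def
  proof (intro allI)
    fix i
    have "q (i + d + n) = q (i + d)" and "q (i + d) < k" and "q (i + d) \<noteq> p (i + d + Suc s)"
      and "q (i + d) \<noteq> p (Suc i + d + Suc s)" and "q (i + d) \<noteq> q (Suc i + d)"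
      using q unfolding cycle_extension_def by (auto simp del: add_Suc_right)
    then show "q (i + n + d) = q (i + d) \<and> q (i + d) < k \<and> q (i + d) \<noteq> p i \<and>
        q (i + d) \<noteq> p (Suc i) \<and> q (i + d) \<noteq> q (Suc i + d)"
      unfolding pd by (simp add: ac_simps)
  qed
  then show ?thesis by blast
next
  case False
  then have alt: "p s \<noteq> p (Suc s)" "p (Suc (Suc s)) = p s" for s by metis+
  have two: "(p i = p 0 \<and> p (Suc i) = p 1) \<or> (p i = p 1 \<and> p (Suc i) = p 0)" for i
    by (induction i) (use alt in auto)
  obtain a where a: "a < k" "a \<noteq> p 0" "a \<noteq> p 1"
    using ex_colour_avoiding_three[OF k] by blast
  obtain b where b: "b < k" "b \<noteq> p 0" "b \<noteq> p 1" "b \<noteq> a"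
    using ex_colour_avoiding_three[OF k] by blast
  \<comment> \<open>Choosing by the value of \<open>p i\<close> rather than by the parity of
    \<open>i\<close> lets the new sequence inherit the period \<open>n\<close>.\<close>
  have "cycle_extension k n p (\<lambda>i. if p i = p 0 then a else b)"
    unfolding cycle_extension_def
  proof (intro allI)
    fix i
    show "(if p (i + n) = p 0 then a else b) = (if p i = p 0 then a else b) \<and>
        (if p i = p 0 then a else b) < k \<and> (if p i = p 0 then a else b) \<noteq> p i \<and>
        (if p i = p 0 then a else b) \<noteq> p (Suc i) \<and>
        (if p i = p 0 then a else b) \<noteq> (if p (Suc i) = p 0 then a else b)"
      using two[of i] a b per[of i] alt(1)[of 0] by auto
  qed
  then show ?thesis by blast
qed

section \<open>Edge colourings of forests\<close>

text \<open>The vertex \<open>x\<close> is the first one of a longest path: a second edge at it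
  would either leave the path and prolong it, or return to the path and close a cycle.\<close>

lemma acyclic_graph_ex_degree_one:
  assumes fin: "finite V" and sub: "\<And>e. e \<in> E \<Longrightarrow> e \<subseteq> V \<and> card e = 2"
    and acyc: "acyclic_graph (V, E)" and ne: "E \<noteq> {}"
  shows "\<exists>x y. {x, y} \<in> E \<and> x \<noteq> y \<and> (\<forall>e \<in> E. x \<in> e \<longrightarrow> e = {x, y})"
proof -
  \<comment> \<open>Two vertices are demanded so that the path has a first edge.\<close>
  define path where "path xs \<longleftrightarrow> distinct xs \<and> 2 \<le> length xs \<and>
    (\<forall>i. Suc i < length xs \<longrightarrow> {xs ! i, xs ! Suc i} \<in> E)" for xs
  obtain e where "e \<in> E" using ne by blast
  then obtain a b where ab: "{a, b} \<in> E" "a \<noteq> b" using sub by (metis card_2_iff)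
  have "path [a, b]" using ab by (auto simp: path_def)
  moreover have "\<forall>xs. path xs \<longrightarrow> length xs \<le> card V"
  proof (intro allI impI)
    fix xs assume xs: "path xs"
    have "xs ! i \<in> V" if "i < length xs" for i
    proof (cases i)
      case 0
      then have "{xs ! 0, xs ! Suc 0} \<in> E" using xs by (auto simp: path_def)
      then show ?thesis using sub 0 by auto
    next
      case (Suc j)
      then have "{xs ! j, xs ! i} \<in> E" using xs that by (auto simp: path_def)
      then show ?thesis using sub by auto
    qed
    then have "set xs \<subseteq> V" by (auto simp: in_set_conv_nth)
    then show "length xs \<le> card V"
      using xs fin by (metis card_mono distinct_card path_def)
  qed
  ultimately obtain xs where xs: "path xs" and max: "\<And>ys. path ys \<Longrightarrow> length ys \<le> length xs"
    using ex_has_greatest_nat[of path "[a, b]" length "Suc (card V)"] by (auto simp: less_Suc_eq_le)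
  let ?x = "xs ! 0" and ?y = "xs ! Suc 0"
  have len: "2 \<le> length xs" and dist: "distinct xs" and edge: "{?x, ?y} \<in> E"
    using xs by (auto simp: path_def)
  have "f = {?x, ?y}" if f: "f \<in> E" "?x \<in> f" for f
  proof (rule ccontr)
    assume neq: "f \<noteq> {?x, ?y}"
    obtain u w where uw: "f = {u, w}" "u \<noteq> w" using sub[OF f(1)] by (meson card_2_iff)
    obtain z where z: "f = {?x, z}" "z \<noteq> ?x"
    proof (cases "?x = u")
      case True
      then show thesis using that[of w] uw by simp
    next
      case False
      then show thesis using that[of u] uw f(2) by (simp add: insert_commute)
    qed
    show False
    proof (cases "z \<in> set xs")
      case False
      have "path (z # xs)"
        unfolding path_def
      proof (intro conjI allI impI)
        fix i assume "Suc i < length (z # xs)"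
        then show "{(z # xs) ! i, (z # xs) ! Suc i} \<in> E"
          using xs z(1) f(1) by (cases i) (auto simp: path_def insert_commute)
      qed (use False dist len in auto)
      then show False using max by fastforce
    next
      case True
      then obtain j where j: "j < length xs" "z = xs ! j" by (metis in_set_conv_nth)
      have "j \<noteq> 0" "j \<noteq> Suc 0" using z j neq by auto
      then have j2: "2 \<le> j" by simp
      \<comment> \<open>The edge \<open>f\<close> closes the initial segment ending in
        \<open>z\<close> to a cycle; it has at least three vertices, as \<open>z\<close> is neither
        of the first two.\<close>
      let ?c = "take (Suc j) xs"
      have lc: "length ?c = Suc j" using j by simp
      have "cycle_edges ?c \<subseteq> E"
      proof
        fix g assume "g \<in> cycle_edges ?c"
        then obtain i where i: "i < Suc j" "g = {?c ! i, ?c ! (Suc i mod Suc j)}"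
          unfolding cycle_edges_def lc by blast
        show "g \<in> E"
        proof (cases "i = j")
          case True
          then show ?thesis using i z f j by (simp add: insert_commute)
        next
          case False
          then have "Suc i mod Suc j = Suc i" using i by simp
          then show ?thesis using i False xs j by (auto simp: path_def)
        qed
      qed
      moreover have "distinct ?c" "3 \<le> length ?c" using dist j2 lc by simp_all
      ultimately show False using acyc unfolding acyclic_graph_def snd_conv by blast
    qed
  qed
  moreover have "?x \<noteq> ?y" 
  proof
    assume "?x = ?y"
    then show False using sub[OF edge] by simp
  qed
  ultimately show ?thesis using edge by blast
qed

text \<open>By induction on the edge set, an edge \<open>{x, y}\<close> whose end \<open>x\<close>
  lies on no other edge is removed and coloured last. It then meets other edges only at
  \<open>y\<close>, and there are at most \<open>k - 1\<close> of these.\<close>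

lemma acyclic_graph_edge_colouring:
  assumes "simple_graph (V, E)" "acyclic_graph (V, E)" "\<And>v. vdegree (V, E) v \<le> k"
  shows "\<exists>c. proper_edge_colouring (V, E) k c"
proof -
  have fin: "finite V" using assms(1) by (simp add: simple_graph_def)
  have "E \<subseteq> Pow V" using assms(1) by (auto simp: simple_graph_def)
  then have "finite E" using fin by (meson finite_Pow_iff rev_finite_subset)
  then show ?thesis using assms
  proof (induction E rule: finite_psubset_induct)
    case (psubset E)
    have sub: "\<And>e. e \<in> E \<Longrightarrow> e \<subseteq> V \<and> card e = 2" using psubset.prems(1) by (auto simp: simple_graph_def)
    show ?case
    proof (cases "E = {}")
      case True
      then show ?thesis by (simp add: proper_edge_colouring_def)
    next
      case False
      then obtain x y where xy: "{x, y} \<in> E" "x \<noteq> y" and x: "\<And>e. e \<in> E \<Longrightarrow> x \<in> e \<Longrightarrow> e = {x, y}"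
        using acyclic_graph_ex_degree_one[OF fin sub psubset.prems(2)] by blast
      define F where "F = E - {{x, y}}"
      have FE: "F \<subset> E" using xy by (auto simp: F_def)
      have deg: "vdegree (V, F) v \<le> k" for v
      proof -
        have "vdegree (V, F) v \<le> vdegree (V, E) v"
          unfolding vdegree_def by (rule card_mono) (use FE psubset.hyps in auto)
        then show ?thesis using psubset.prems(3) by (rule order_trans)
      qed
      have "simple_graph (V, F)" "acyclic_graph (V, F)"
        using psubset.prems(1,2) FE unfolding simple_graph_def acyclic_graph_def fst_conv snd_conv by blast+
      then obtain c where c: "proper_edge_colouring (V, F) k c"
        using psubset.IH[OF FE] deg by blast
      let ?A = "{e \<in> F. y \<in> e}"
      have "{e \<in> E. y \<in> e} = insert {x, y} ?A" using xy by (auto simp: F_def)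
      moreover have "finite ?A" using psubset.hyps FE by (simp add: F_def)
      ultimately have "Suc (card ?A) \<le> k"
        using psubset.prems(3)[of y] by (simp add: vdegree_def F_def)
      then have "card (c ` ?A) < k"
        using card_image_le[OF \<open>finite ?A\<close>, of c] by linarith
      then obtain a where a: "a < k" "a \<notin> c ` ?A"
        using ex_colour_not_in \<open>finite ?A\<close> by blast
      \<comment> \<open>An old edge can touch the reinserted one only at \<open>y\<close>, where
        \<open>a\<close> is not in use.\<close>
      have new: "e = {x, y} \<or> (e \<in> F \<and> e \<noteq> {x, y} \<and> (e \<inter> {x, y} \<noteq> {} \<longrightarrow> c e \<noteq> a))"
        if "e \<in> E" for e
      proof (cases "e = {x, y}")
        case False
        then have "e \<in> F" "x \<notin> e" using that x by (auto simp: F_def)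
        then show ?thesis using False a(2) by blast
      qed simp
      have "proper_edge_colouring (V, E) k (c({x, y} := a))"
        unfolding proper_edge_colouring_def
      proof (intro conjI ballI impI)
        fix e assume "e \<in> edges (V, E)"
        then show "(c({x, y} := a)) e < k"
          using new[of e] a(1) c by (auto simp: proper_edge_colouring_def)
      next
        fix e f assume "e \<in> edges (V, E)" "f \<in> edges (V, E)" and ef: "e \<noteq> f \<and> e \<inter> f \<noteq> {}"
        then have e: "e \<in> E" and f: "f \<in> E" by auto
        consider "e = {x, y}" | "f = {x, y}" | "e \<noteq> {x, y}" "f \<noteq> {x, y}" by blast
        then show "(c({x, y} := a)) e \<noteq> (c({x, y} := a)) f"
        proof cases
          case 1
          then show ?thesis using new[OF f] ef by (metis fun_upd_apply inf_commute)
        next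
          case 2
          then show ?thesis using new[OF e] ef by (metis fun_upd_apply)
        next
          case 3
          then show ?thesis using new[OF e] new[OF f] ef c by (auto simp: proper_edge_colouring_def)
        qed
      qed
      then show ?thesis by blast
    qed
  qed
qed

section \<open>Chromatic index and maximum degree\<close>

text \<open>Stated for every \<open>v\<close>, as \<open>acyclic_graph_edge_colouring\<close> asks
  for; outside the vertex set the degree is 0.\<close>

lemma vdegree_le_max_degree:
  assumes "simple_graph H"
  shows "vdegree H v \<le> max_degree H"
proof (cases "v \<in> vertices H")
  case True
  then show ?thesis using assms by (simp add: max_degree_def simple_graph_def)
next
  case False
  then have "{e \<in> edges H. v \<in> e} = {}" using assms by (auto simp: simple_graph_def)
  then have "vdegree H v = 0" by (simp only: vdegree_def card.empty)
  then show ?thesis by simp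
qed

text \<open>The edges at one vertex meet pairwise, so a proper colouring is injective on
  them.\<close>

lemma max_degree_le_colours:
  assumes "simple_graph H" "proper_edge_colouring H k c"
  shows "max_degree H \<le> k"
proof -
  have "vdegree H v \<le> k" for v
  proof -
    have "inj_on c {e \<in> edges H. v \<in> e}"
      using assms(2) by (fastforce simp: proper_edge_colouring_def inj_on_def)
    moreover have "c ` {e \<in> edges H. v \<in> e} \<subseteq> {..<k}"
      using assms(2) by (auto simp: proper_edge_colouring_def)
    ultimately show ?thesis
      unfolding vdegree_def by (metis card_inj_on_le card_lessThan finite_lessThan)
  qed
  then show ?thesis using assms(1) by (auto simp: max_degree_def simple_graph_def)
qed

lemma chromatic_index_eq_max_degreeI:
  assumes "simple_graph H" "proper_edge_colouring H (max_degree H) c"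
  shows "chromatic_index H = max_degree H"
  unfolding chromatic_index_def
  by (rule Least_equality) (use assms max_degree_le_colours in blast)+

section \<open>From the tree to the Halin graph\<close>

text \<open>Each leaf lies on exactly one tree edge, so the cycle sees only one colour of
  \<open>c\<close> per leaf and \<open>cycle_extension_exists\<close> applies. Colours are chosen
  around the whole cycle even if \<open>E\<close> lacks some of its edges, since absent edges only
  drop constraints.\<close>

lemma edge_colouring_extends_to_leaf_cycle:
  assumes k: "4 \<le> k" and n: "3 \<le> length ls" and dist: "distinct ls" and leaf: "set ls \<subseteq> leaves T"
    and c: "proper_edge_colouring (V, E \<inter> edges T) k c" and E: "E \<subseteq> edges T \<union> cycle_edges ls"
  shows "\<exists>d. proper_edge_colouring (V, E) k d"
proof -
  let ?n = "length ls"
  define pend where "pend v = (THE e. e \<in> edges T \<and> v \<in> e)" for v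
  have pend: "e = pend v" if "v \<in> set ls" "e \<in> edges T" "v \<in> e" for v e
  proof -
    have "card {e \<in> edges T. v \<in> e} = 1" using that(1) leaf by (auto simp: leaves_def vdegree_def)
    then obtain f where "{e \<in> edges T. v \<in> e} = {f}" by (metis card_1_singletonE)
    then have f: "e' \<in> edges T \<and> v \<in> e' \<longleftrightarrow> e' = f" for e' by blast
    then have "pend v = f" by (simp add: pend_def)
    then show ?thesis using f that by blast
  qed
  \<comment> \<open>A pendant edge outside \<open>E\<close> has an unspecified colour; the reduction only serves to bound it.\<close>
  define p where "p i = c (pend (ls ! (i mod ?n))) mod k" for i
  obtain q where "cycle_extension k ?n p q"
    using cycle_extension_exists[OF k n, of p] k by (auto simp: p_def)
  then have q: "q (i + ?n) = q i" "q i < k" "q i \<noteq> p i" "q i \<noteq> p (Suc i)" "q i \<noteq> q (Suc i)" for i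
    by (simp_all add: cycle_extension_def)
  \<comment> \<open>Any position that represents the edge on \<open>ls\<close> serves.\<close>
  define idx where "idx e = (SOME i. i < ?n \<and> e = {ls ! i, ls ! (Suc i mod ?n)})" for e
  define d where "d e = (if e \<in> edges T then c e else q (idx e))" for e
  have cycle_edge: "\<exists>i < ?n. e = {ls ! i, ls ! (Suc i mod ?n)} \<and> d e = q i"
    if "e \<in> E" "e \<notin> edges T" for e
  proof -
    have "\<exists>i. i < ?n \<and> e = {ls ! i, ls ! (Suc i mod ?n)}"
      using that E unfolding cycle_edges_def by blast
    then have "idx e < ?n \<and> e = {ls ! idx e, ls ! (Suc (idx e) mod ?n)}"
      unfolding idx_def by (rule someI_ex)
    moreover have "d e = q (idx e)" using that by (simp add: d_def)
    ultimately show ?thesis by blast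
  qed
  \<comment> \<open>The tree edge contains a leaf at one end of the cycle edge, so it is the pendant
    edge there. Being in \<open>E\<close> it has a colour below \<open>k\<close>, so the reduction
    in \<open>p\<close> leaves that colour unchanged.\<close>
  have mixed: "d e \<noteq> d f"
    if e: "e \<in> E" "e \<in> edges T" and f: "f \<in> E" "f \<notin> edges T" and "e \<inter> f \<noteq> {}" for e f
  proof -
    obtain i where i: "i < ?n" "f = {ls ! i, ls ! (Suc i mod ?n)}" "d f = q i"
      using cycle_edge[OF f] by blast
    have "c e < k" using c e by (auto simp: proper_edge_colouring_def)
    have de: "d e = c e" using e by (simp add: d_def)
    have "ls ! i \<in> e \<or> ls ! (Suc i mod ?n) \<in> e" using i(2) \<open>e \<inter> f \<noteq> {}\<close> by blast
    then show ?thesis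
    proof
      assume "ls ! i \<in> e"
      then have "e = pend (ls ! i)" using e(2) i(1) by (intro pend nth_mem)
      then have "p i = c e" using i(1) \<open>c e < k\<close> by (simp add: p_def)
      then show ?thesis using q(3)[of i] de i(3) by metis
    next
      assume *: "ls ! (Suc i mod ?n) \<in> e"
      have "Suc i mod ?n < ?n" using n by (intro mod_less_divisor) linarith
      then have "ls ! (Suc i mod ?n) \<in> set ls" by (rule nth_mem)
      then have "e = pend (ls ! (Suc i mod ?n))" using e(2) * by (rule pend)
      then have "p (Suc i) = c e" using \<open>c e < k\<close> by (simp add: p_def)
      then show ?thesis using q(4)[of i] de i(3) by metis
    qed
  qed
  \<comment> \<open>Edge \<open>i\<close> starts where edge \<open>j\<close> ends, so they are
    consecutive; periodicity covers the case \<open>i = 0\<close>.\<close>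
  have cyc: "q i \<noteq> q j" if "i < ?n" "j < ?n" "ls ! i = ls ! (Suc j mod ?n)" for i j
  proof -
    have "Suc j mod ?n < ?n" using n by (intro mod_less_divisor) linarith
    then have "i = Suc j mod ?n" using that dist by (simp add: nth_eq_iff_index_eq)
    then have "q i = q (Suc j)" using periodic_mod[of q ?n "Suc j"] q(1) by simp
    then show ?thesis using q(5)[of j] by simp
  qed
  have "proper_edge_colouring (V, E) k d"
    unfolding proper_edge_colouring_def
  proof (intro conjI ballI impI)
    fix e assume "e \<in> edges (V, E)"
    then show "d e < k" using c q(2) by (auto simp: d_def proper_edge_colouring_def)
  next
    fix e f assume "e \<in> edges (V, E)" "f \<in> edges (V, E)" and ef: "e \<noteq> f \<and> e \<inter> f \<noteq> {}"
    then have e: "e \<in> E" and f: "f \<in> E" by auto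
    consider "e \<in> edges T" "f \<in> edges T" | "e \<in> edges T" "f \<notin> edges T"
      | "e \<notin> edges T" "f \<in> edges T" | "e \<notin> edges T" "f \<notin> edges T" by blast
    then show "d e \<noteq> d f"
    proof cases
      case 1
      then show ?thesis using c e f ef by (simp add: d_def proper_edge_colouring_def)
    next
      case 2
      then show ?thesis using mixed e f ef by blast
    next
      case 3
      then show ?thesis using mixed[of f e] e f ef by (metis inf_commute)
    next
      case 4
      obtain i where i: "i < ?n" "e = {ls ! i, ls ! (Suc i mod ?n)}" "d e = q i"
        using cycle_edge[OF e 4(1)] by blast
      obtain j where j: "j < ?n" "f = {ls ! j, ls ! (Suc j mod ?n)}" "d f = q j"
        using cycle_edge[OF f 4(2)] by blast
      \<comment> \<open>Different positions exclude a common first end and a common second end, so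
        the shared leaf is the first end of one edge and the second end of the other.\<close>
      have ij: "i \<noteq> j" using i(2) j(2) ef by blast
      have "Suc i mod ?n < ?n" "Suc j mod ?n < ?n" using n by (intro mod_less_divisor; linarith)+
      moreover have "Suc i mod ?n \<noteq> Suc j mod ?n"
        using ij i(1) j(1) by (auto simp: mod_Suc split: if_splits)
      ultimately have "ls ! i \<noteq> ls ! j" "ls ! (Suc i mod ?n) \<noteq> ls ! (Suc j mod ?n)"
        using dist i(1) j(1) ij by (simp_all add: nth_eq_iff_index_eq)
      then have "ls ! i = ls ! (Suc j mod ?n) \<or> ls ! j = ls ! (Suc i mod ?n)"
        using conjunct2[OF ef] unfolding i(2) j(2) by auto
      then show ?thesis using cyc[of i j] cyc[of j i] i j by metis
    qed
  qed
  then show ?thesis by blast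
qed

theorem proposition2p2:
  fixes G H :: "'a ugraph"
  assumes "halin_graph G"
    and "is_subgraph H G"
    and "max_degree H \<ge> 4"
  shows "chromatic_index H = max_degree H"
proof -
  obtain T rot ls where T: "plane_tree T rot" and ls: "leaf_cycle T rot ls"
    and G: "G = (vertices T, edges T \<union> cycle_edges ls)"
    using assms(1) unfolding halin_graph_def by blast
  have H: "simple_graph H" and sub: "edges H \<subseteq> edges T \<union> cycle_edges ls"
    using assms(2) G by (auto simp: is_subgraph_def)
  \<comment> \<open>The tree part of \<open>H\<close> is a forest with degrees at most
    \<open>max_degree H\<close>, so that many colours suffice for it.\<close>
  let ?F = "(vertices H, edges H \<inter> edges T)"
  have "acyclic_graph T" using T by (simp add: plane_tree_def is_tree_def)
  then have acyc: "acyclic_graph ?F" by (auto simp: acyclic_graph_def)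
  have simp: "simple_graph ?F" using H by (auto simp: simple_graph_def)
  have "edges H \<subseteq> Pow (vertices H)" "finite (vertices H)" using H by (auto simp: simple_graph_def)
  then have fin: "finite (edges H)" by (meson finite_Pow_iff rev_finite_subset)
  have deg: "vdegree ?F v \<le> max_degree H" for v
  proof -
    have "vdegree ?F v \<le> vdegree H v"
      unfolding vdegree_def by (rule card_mono) (use fin in auto)
    then show ?thesis using vdegree_le_max_degree[OF H] by (rule order_trans)
  qed
  obtain c where "proper_edge_colouring ?F (max_degree H) c"
    using acyclic_graph_edge_colouring[OF simp acyc deg] by blast
  moreover have "3 \<le> length ls" "distinct ls" "set ls \<subseteq> leaves T"
    using ls by (simp_all add: leaf_cycle_def)
  \<comment> \<open>The bound of 4 on the maximum degree enters here, as the number of colours that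
    the cycle requires.\<close>
  ultimately obtain d where "proper_edge_colouring (vertices H, edges H) (max_degree H) d"
    using edge_colouring_extends_to_leaf_cycle assms(3) sub by blast
  then show ?thesis using chromatic_index_eq_max_degreeI[OF H] by simp
qed

end
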